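(* Let $\mathcal A$ be a finite alphabet and let $W$ be an infinite word over $\mathcal A$ that is aperiodic and recurrent. Then $W$ contains a $5$-anti-power as a factor; that is, there exist finite words $w_1,\ldots,w_5$ that all have the same length, are pairwise distinct, and are such that the concatenation $w_1w_2w_3w_4w_5$ is a factor of $W$.
   Context: Words are sequences of letters from a finite alphabet. An infinite word is infinite to the right only, i.e. a sequence of letters indexed by $1,2,3,\ldots$. A factor of a word is a contiguous subword. An infinite word is aperiodic if it is not eventually periodic. An infinite word $W$ is recurrent if every finite factor of $W$ occurs infinitely often in $W$. A $k$-anti-power is a word formed by concatenating $k$ consecutive words (called blocks) that all have the same length and are pairwise distinct. *)

theory Defs
  imports "HOL-Library.Omega_Words_Fun"
begin

text \<open>
  Infinite words are functions on \<^typ>\<open>nat\<close>, so positions start at 0 rather than at 1.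
\<close>

definition occurs_at :: "'a list \<Rightarrow> 'a word \<Rightarrow> nat \<Rightarrow> bool" where
  "occurs_at u W i \<longleftrightarrow> W [i \<rightarrow> i + length u] = u"

definition factor :: "'a list \<Rightarrow> 'a word \<Rightarrow> bool" where
  "factor u W \<longleftrightarrow> (\<exists>i. occurs_at u W i)"

definition eventually_periodic :: "'a word \<Rightarrow> bool" where
  "eventually_periodic W \<longleftrightarrow> (\<exists>p>0. \<exists>N. \<forall>n\<ge>N. W (n + p) = W n)"

definition aperiodic :: "'a word \<Rightarrow> bool" where
  "aperiodic W \<longleftrightarrow> \<not> eventually_periodic W"

definition recurrent :: "'a word \<Rightarrow> bool" where
  "recurrent W \<longleftrightarrow> (\<forall>u. factor u W \<longrightarrow> (\<exists>\<^sub>\<infinity>i. occurs_at u W i))"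

text \<open>
  The common block length need not be required to be positive: for \<open>k \<ge> 2\<close> this follows from
  the blocks being pairwise distinct.
\<close>

definition anti_power :: "nat \<Rightarrow> 'a list \<Rightarrow> bool" where
  "anti_power k w \<longleftrightarrow>
     (\<exists>ws. length ws = k \<and> (\<exists>m. \<forall>u\<in>set ws. length u = m) \<and> distinct ws \<and> w = concat ws)"

end

theory Submission
  imports Defs
begin

text \<open>
  Suppose that no 5-anti-power occurs. Fix a cut \<open>t\<close> and consider, for eleven consecutive block
  lengths, five blocks of that length with the cut between the first two. Two of the lengths, at
  distance \<open>d\<close>, have the same pair \<open>i < l\<close> of equal blocks, and comparing the two equalities shows
  that the blocks \<open>i\<close> and \<open>l\<close> have period \<open>(l - i) * d \<le> 40\<close> up to a margin. So \<open>W\<close> contains long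
  runs of some period \<open>p \<le> 40\<close>, and by aperiodicity and recurrence a long run that is maximal
  on both sides. By recurrence it has two copies at a large distance \<open>T\<close>, far from the start of
  \<open>W\<close>. Put the cut inside the first copy and take block lengths close to \<open>T / 3\<close>: then the cut
  between the last two blocks lies inside the second copy. Of any two blocks, one is adjacent to a
  cut, hence contains an end of the run together with a long part of the run. Its short period
  then carries the period \<open>p\<close> across the end of the run, contradicting maximality.
\<close>

lemma anti_power_factorI:
  assumes "\<And>i l. i < l \<Longrightarrow> l < k \<Longrightarrow> \<exists>x<m. W (j + i * m + x) \<noteq> W (j + l * m + x)"
  shows "\<exists>w. anti_power k w \<and> factor w W"
proof -
  define B where "B i = W [j + i * m \<rightarrow> j + i * m + m]" for i
  have len: "length (B i) = m" for i
    by (simp add: B_def)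
  have nth: "B i ! x = W (j + i * m + x)" if "x < m" for i x
    using that by (simp add: B_def)
  have neq: "B i \<noteq> B l" if "i < l" "l < k" for i l
    using assms[OF that] nth by metis
  have "inj_on B {..<k}"
    by (rule linorder_inj_onI) (use neq in auto)
  then have dist: "distinct (map B [0..<k])"
    by (simp add: distinct_map atLeast0LessThan)
  have cat: "concat (map B [0..<n]) = W [j \<rightarrow> j + n * m]" for n
  proof (induction n)
    case (Suc n)
    have "W [j \<rightarrow> j + n * m] @ B n = W [j \<rightarrow> j + n * m + m]"
      unfolding B_def subsequence_def
      by (simp flip: map_append upt_add_eq_append)
    with Suc show ?case by (simp add: algebra_simps)
  qed simp
  have "anti_power k (W [j \<rightarrow> j + k * m])"
    unfolding anti_power_def
    by (rule exI[of _ "map B [0..<k]"]) (use len dist cat in auto)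
  moreover have "factor (W [j \<rightarrow> j + k * m]) W"
    unfolding factor_def occurs_at_def by (rule exI[of _ j]) simp
  ultimately show ?thesis by blast
qed

lemma recurrent_later_copy:
  assumes "recurrent W"
  obtains S where "S \<ge> N" "\<And>x. x < n \<Longrightarrow> W (S + x) = W (b + x)"
proof -
  have "factor (W [b \<rightarrow> b + n]) W"
    unfolding factor_def occurs_at_def by (rule exI[of _ b]) simp
  with assms have "\<exists>\<^sub>\<infinity>S. occurs_at (W [b \<rightarrow> b + n]) W S"
    by (auto simp: recurrent_def)
  then obtain S where S: "S \<ge> N" "W [S \<rightarrow> S + n] = W [b \<rightarrow> b + n]"
    by (auto simp: INFM_nat_le occurs_at_def)
  show thesis
  proof (rule that[OF S(1)])
    fix x assume "x < n"
    then show "W (S + x) = W (b + x)"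
      using arg_cong[OF S(2), of "\<lambda>u. u ! x"] by simp
  qed
qed

text \<open>Equal blocks give \<open>W z = W (z + (l - i) * (m + e))\<close> on block
  \<open>i\<close>, for \<open>e = c\<close> and \<open>e = c + d\<close>. Equating the targets
  yields the period in block \<open>i\<close>, equating the sources yields it in block
  \<open>l\<close>. The bound on \<open>t\<close> lets block 0, which ends at \<open>t\<close>, fit
  for all eleven lengths.\<close>

lemma repeated_block_period:
  fixes W :: "'a word"
  assumes no: "\<nexists>w. anti_power 5 w \<and> factor w W" and t: "t \<ge> m + 10"
  obtains i l c d where "i < l" "l \<le> 4" "d \<ge> 1" "c + d \<le> 10"
    "\<And>z. t + i * (m + c + d) \<le> z + (m + c + d) \<Longrightarrow> z + (l - i) * d < t + i * (m + c)
       \<Longrightarrow> W z = W (z + (l - i) * d)"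
    "\<And>z. t + l * (m + c) + i * d \<le> z + (m + c) \<Longrightarrow> z < t + l * (m + c)
       \<Longrightarrow> W z = W (z + (l - i) * d)"
proof -
  define E where "E c i l \<longleftrightarrow>
    (\<forall>x<m + c. W (t - (m + c) + i * (m + c) + x) = W (t - (m + c) + l * (m + c) + x))" for c i l
  \<comment> \<open>Ten pairs against the eleven values \<open>0..10\<close> of
    \<open>c\<close>.\<close>
  define Pairs where "Pairs = {(0::nat,1::nat),(0,2),(0,3),(0,4),(1,2),(1,3),(1,4),(2,3),(2,4),(3,4)}"
  have "\<exists>ij\<in>Pairs. E c (fst ij) (snd ij)" for c
  proof -
    obtain i l where il: "i < l" "l < 5" "E c i l"
      using anti_power_factorI[of 5 "m + c" W "t - (m + c)"] no unfolding E_def by blast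
    have "(i, l) \<in> Pairs"
      using il(1,2) by (auto simp: Pairs_def less_Suc_eq numeral_eq_Suc)
    with il show ?thesis by force
  qed
  then obtain f where f: "\<And>c. f c \<in> Pairs" "\<And>c. E c (fst (f c)) (snd (f c))"
    by metis
  have "card (f ` {0..10}) \<le> card Pairs"
  proof (rule card_mono)
    show "f ` {0..10} \<subseteq> Pairs" using f(1) by blast
  qed (simp add: Pairs_def)
  also have "\<dots> < card {0..10::nat}"
    by (simp add: Pairs_def)
  finally have "\<not> inj_on f {0..10}"
    using pigeonhole by blast
  then obtain c c' where c: "c < c'" "c' \<le> 10" "f c = f c'"
    unfolding inj_on_def by (metis atLeastAtMost_iff linorder_neqE_nat)
  define d where "d = c' - c"
  have c': "c' = c + d" and d: "d \<ge> 1" "c + d \<le> 10" using c by (auto simp: d_def)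
  obtain i l where il: "f c = (i, l)" by fastforce
  have "(i, l) \<in> Pairs" using f(1)[of c] il by simp
  then have ord: "i < l" "l \<le> 4" by (auto simp: Pairs_def)
  have E: "W z = W (z + (l - i) * (m + e))"
    if "e = c \<or> e = c + d" "t + i * (m + e) \<le> z + (m + e)" "z < t + i * (m + e)" for e z
  proof -
    have "E e i l" using f(2) c(3) il c' that(1) by (metis fst_conv snd_conv)
    define x where "x = z + (m + e) - (t + i * (m + e))"
    have x: "x < m + e" "z = t - (m + e) + i * (m + e) + x"
      using that t d by (auto simp: x_def)
    have "l * (m + e) = i * (m + e) + (l - i) * (m + e)"
      using ord by (simp flip: add_mult_distrib)
    then have "t - (m + e) + l * (m + e) + x = z + (l - i) * (m + e)"
      using x(2) by linarith
    with \<open>E e i l\<close> x show ?thesis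
      unfolding E_def by metis
  qed
  define k where "k = l - i"
  note E = E[folded k_def]
  have k: "l = i + k" using ord by (simp add: k_def)
  \<comment> \<open>For \<open>i = 0\<close> the shorter block starts \<open>d\<close> later than
    the longer one; the shift by \<open>k * d\<close> makes up for it.\<close>
  have "d \<le> (i + k) * d" using ord k by simp
  then have dk: "d \<le> i * d + k * d" by (simp add: add_mult_distrib)
  show thesis
  proof (rule that[OF ord d])
    fix z assume z: "t + i * (m + c + d) \<le> z + (m + c + d)" "z + (l - i) * d < t + i * (m + c)"
    \<comment> \<open>Both \<open>z\<close> and \<open>z + k * d\<close> are sent to
      \<open>z + k * (m + c + d)\<close>.\<close>
    have "W (z + k * d) = W (z + k * d + k * (m + c))"
      using z[folded k_def] dk by (intro E) (auto simp: algebra_simps)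
    moreover have "W z = W (z + k * (m + (c + d)))"
      using z[folded k_def] by (intro E) (auto simp: algebra_simps)
    ultimately show "W z = W (z + (l - i) * d)"
      by (simp add: k_def algebra_simps)
  next
    fix z assume z: "t + l * (m + c) + i * d \<le> z + (m + c)" "z < t + l * (m + c)"
    \<comment> \<open>Now a single source \<open>y\<close> in block \<open>i\<close> is sent to both
      \<open>z\<close> and \<open>z + k * d\<close>.\<close>
    define y where "y = z - k * (m + c)"
    have "k * (m + c) \<le> z"
      using z t k d by (simp add: algebra_simps)
    then have y: "z = y + k * (m + c)" by (simp add: y_def)
    have "W y = W (y + k * (m + c))"
      using z y k by (intro E) (auto simp: algebra_simps)
    moreover have "W y = W (y + k * (m + (c + d)))"
      using z y k by (intro E) (auto simp: algebra_simps)
    ultimately show "W z = W (z + (l - i) * d)"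
      by (simp add: y k_def algebra_simps)
  qed
qed

lemma small_index_product:
  fixes i l d :: nat
  assumes "i < l" "l \<le> 4" "d \<ge> 1" "d \<le> 10"
  shows "(l - i) * d \<ge> 1" "(l - i) * d \<le> 40"
proof -
  show "(l - i) * d \<ge> 1" using assms by simp
  have "(l - i) * d \<le> 4 * 10" using assms by (intro mult_le_mono) auto
  then show "(l - i) * d \<le> 40" by simp
qed

lemma long_run:
  fixes W :: "'a word"
  assumes no: "\<nexists>w. anti_power 5 w \<and> factor w W"
  obtains p r where "p \<ge> 1" "p \<le> 40" "\<And>x. x < n \<Longrightarrow> W (r + x) = W (r + x + p)"
proof -
  \<comment> \<open>The slack 100 absorbs the offset \<open>i * d \<le> 40\<close> and the period,
    also at most 40.\<close>
  define m where "m = n + 100"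
  obtain i l c d where *: "i < l" "l \<le> 4" "d \<ge> 1" "c + d \<le> 10"
    "\<And>z. m + 10 + i * (m + c + d) \<le> z + (m + c + d) \<Longrightarrow> z + (l - i) * d < m + 10 + i * (m + c)
       \<Longrightarrow> W z = W (z + (l - i) * d)"
    by (rule repeated_block_period[OF no, of m "m + 10"]) auto
  have q: "(l - i) * d \<ge> 1" "(l - i) * d \<le> 40"
    by (rule small_index_product; use * in simp)+
  have "i * d \<le> 4 * 10" using * by (intro mult_le_mono) auto
  then show thesis
    using * q by (intro that[of "(l - i) * d" "10 + i * (m + c + d)"])
      (auto intro!: *(5) simp: m_def algebra_simps)
qed

lemma maximal_run:
  fixes W :: "'a word"
  assumes no: "\<nexists>w. anti_power 5 w \<and> factor w W"
    and "aperiodic W" and rec: "recurrent W"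
  obtains p g h where "p \<ge> 1" "p \<le> 40" "g + n \<le> h"
    "W g \<noteq> W (g + p)" "W h \<noteq> W (h + p)" "\<And>x. g < x \<Longrightarrow> x < h \<Longrightarrow> W x = W (x + p)"
proof -
  obtain p r where p: "p \<ge> 1" "p \<le> 40" and r: "\<And>x. x < n \<Longrightarrow> W (r + x) = W (r + x + p)"
    by (rule long_run[OF no, of n]) blast
  define D where "D x \<longleftrightarrow> W x \<noteq> W (x + p)" for x
  have D: "\<exists>x\<ge>N. D x" for N
    using \<open>aperiodic W\<close> p unfolding aperiodic_def eventually_periodic_def D_def
    by (metis less_le_trans zero_less_one)
  obtain e where e: "D e" using D by blast
  \<comment> \<open>The copy lies beyond a failure \<open>e\<close> of the period, so it has a
    failure on its left. Comparing \<open>n\<close> letters with those \<open>p\<close> further on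
    takes \<open>n + p\<close> letters.\<close>
  obtain S where S: "S \<ge> e + 1" "\<And>x. x < n + p \<Longrightarrow> W (S + x) = W (r + x)"
    by (rule recurrent_later_copy[OF rec, of "e + 1" "n + p" r]) blast
  have run: "\<not> D (S + x)" if "x < n" for x
    using that S(2)[of x] S(2)[of "x + p"] r[of x] by (simp add: D_def algebra_simps)
  define g where "g = (GREATEST x. D x \<and> x < S)"
  define h where "h = (LEAST x. D x \<and> S \<le> x)"
  have g: "D g \<and> g < S" unfolding g_def
    by (rule GreatestI_nat[of _ e S]) (use e S in auto)
  have gmax: "x \<le> g" if "D x" "x < S" for x unfolding g_def
    by (rule Greatest_le_nat[of _ _ S]) (use that in auto)
  have h: "D h \<and> S \<le> h" unfolding h_def
    by (rule LeastI_ex) (use D in auto)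
  have hmin: "h \<le> x" if "D x" "S \<le> x" for x unfolding h_def
    by (rule Least_le) (use that in auto)
  have "S + n \<le> h"
    using run[of "h - S"] h by (metis le_add_diff_inverse nat_add_left_cancel_less not_le)
  then have "g + n \<le> h" using g by simp
  moreover have "W x = W (x + p)" if "g < x" "x < h" for x
    using gmax[of x] hmin[of x] that unfolding D_def by (meson leI leD)
  ultimately show thesis
    using that[OF p] g h by (auto simp: D_def)
qed

text \<open>The shift by \<open>q\<close> moves \<open>g\<close> into the run:
  \<open>W g = W (g + q) = W (g + q + p) = W (g + p)\<close>.\<close>

lemma period_crosses_left_end:
  fixes g :: nat
  assumes "W g = W (g + q)" "W (g + p) = W (g + p + q)"
    and "\<And>x. g < x \<Longrightarrow> x < h \<Longrightarrow> W x = W (x + p)" "0 < q" "g + q < h"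
  shows "W g = W (g + p)"
  using assms(1,2,4,5) assms(3)[of "g + q"] by (simp add: add.assoc add.commute[of p q])

text \<open>Symmetrically, \<open>h\<close> is moved back into the run by \<open>q\<close>.\<close>

lemma period_crosses_right_end:
  fixes g :: nat
  assumes "W (h - q) = W (h - q + q)" "W (h + p - q) = W (h + p - q + q)"
    and "\<And>x. g < x \<Longrightarrow> x < h \<Longrightarrow> W x = W (x + p)" "0 < q" "g + q < h"
  shows "W h = W (h + p)"
  using assms(1,2,4,5) assms(3)[of "h - q"] by simp

theorem theorem2:
  fixes A :: "'a set" and W :: "'a word"
  assumes "finite A" and "range W \<subseteq> A"
    and "aperiodic W" and "recurrent W"
  shows "\<exists>w. anti_power 5 w \<and> factor w W"
proof (rule ccontr)
  assume no: "\<nexists>w. anti_power 5 w \<and> factor w W"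
  note rec = \<open>recurrent W\<close>
  obtain p a b where p: "p \<ge> 1" "p \<le> 40" and ab: "a + 300 \<le> b"
    and a: "W a \<noteq> W (a + p)" and b: "W b \<noteq> W (b + p)"
    and run: "\<And>x. a < x \<Longrightarrow> x < b \<Longrightarrow> W x = W (x + p)"
    by (rule maximal_run[OF no \<open>aperiodic W\<close> rec, of 300]) blast
  \<comment> \<open>The window from \<open>a\<close> to \<open>b + p\<close> shows the run and its
    failures at both ends.\<close>
  define n where "n = b + p + 1 - a"
  obtain a2 where a2: "a2 \<ge> a + 3 * n + 3000" "\<And>x. x < n \<Longrightarrow> W (a2 + x) = W (a + x)"
    by (rule recurrent_later_copy[OF rec, of "a + 3 * n + 3000" n a]) blast
  define T where "T = a2 - a"
  \<comment> \<open>Both copies are moved together, to a place with room for block 0 on their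
    left.\<close>
  obtain g where g: "g \<ge> T" "\<And>x. x < T + n \<Longrightarrow> W (g + x) = W (a + x)"
    by (rule recurrent_later_copy[OF rec, of T "T + n" a]) blast
  define L where "L = b - a"
  have n: "n = L + p + 1" and L: "L \<ge> 300" and T: "T \<ge> 3 * n + 3000"
    using ab a2(1) by (auto simp: n_def L_def T_def)
  have copy1: "\<forall>x<n. W (g + x) = W (a + x)"
    using g(2) by simp
  have copy2: "\<forall>x<n. W (g + T + x) = W (a + x)"
  proof (intro allI impI)
    fix x assume "x < n"
    then show "W (g + T + x) = W (a + x)"
      using g(2)[of "T + x"] a2 by (simp add: T_def add.assoc)
  qed
  have ends: "W s \<noteq> W (s + p)" "W (s + L) \<noteq> W (s + L + p)"
    "\<And>x. s < x \<Longrightarrow> x < s + L \<Longrightarrow> W x = W (x + p)"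
    if s: "\<forall>x<n. W (s + x) = W (a + x)" for s
  proof -
    show "W s \<noteq> W (s + p)" using s[rule_format, of 0] s[rule_format, of p] a n by simp
    show "W (s + L) \<noteq> W (s + L + p)"
      using s[rule_format, of L] s[rule_format, of "L + p"] b n ab by (simp add: L_def add.assoc)
    fix x assume "s < x" "x < s + L"
    then show "W x = W (x + p)"
      using s[rule_format, of "x - s"] s[rule_format, of "x - s + p"] run[of "a + (x - s)"] n
      by (simp add: L_def add.assoc)
  qed
  note run1 = ends[of g, OF copy1] and run2 = ends[of "g + T", OF copy2]
  define m where "m = T div 3"
  have m: "3 * m \<le> T" "T \<le> 3 * m + 2" by (auto simp: m_def)
  \<comment> \<open>The cut between blocks 3 and 4 then lies between \<open>g + T + 98\<close> and
    \<open>g + T + 130\<close>. Left of each cut there is room for \<open>p + q \<le> 80\<close>,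
    and \<open>L \<ge> 300\<close> leaves enough of the run on the right.\<close>
  define t where "t = g + 100"
  have "t \<ge> m + 10" using g(1) m by (simp add: t_def)
  then obtain i l c d where il: "i < l" "l \<le> 4" and d: "d \<ge> 1" "c + d \<le> 10" and
    per_i: "\<And>z. t + i * (m + c + d) \<le> z + (m + c + d) \<Longrightarrow> z + (l - i) * d < t + i * (m + c)
       \<Longrightarrow> W z = W (z + (l - i) * d)" and
    per_l: "\<And>z. t + l * (m + c) + i * d \<le> z + (m + c) \<Longrightarrow> z < t + l * (m + c)
       \<Longrightarrow> W z = W (z + (l - i) * d)"
    by (rule repeated_block_period[OF no]) blast
  define q where "q = (l - i) * d"
  have q: "q \<ge> 1" "q \<le> 40"
    unfolding q_def by (rule small_index_product; use il d in simp)+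
  note per_i = per_i[folded q_def] and per_l = per_l[folded q_def]
  note bounds = m n L T p q d t_def
  \<comment> \<open>Block 0 ends and block 1 starts at the first cut, block 3 ends and block 4
    starts at the second. A block ending at a cut contains the left end of the run there, one
    starting at it the right end.\<close>
  consider "i = 0" | "i = 1" | "i = 2 \<and> l = 3" | "(i = 2 \<or> i = 3) \<and> l = 4"
    using il by linarith
  then show False
  proof cases
    case 1
    have "W g = W (g + q)" "W (g + p) = W (g + p + q)"
      by (rule per_i; use bounds 1 in simp)+
    then have "W g = W (g + p)"
      by (rule period_crosses_left_end[of W g q p "g + L"])
        (erule (1) run1(3) | use q L in simp)+
    with run1(1) show False by contradiction
  next
    case 2
    have "W (g + L - q) = W (g + L - q + q)" "W (g + L + p - q) = W (g + L + p - q + q)"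
      by (rule per_i; use bounds 2 in simp)+
    then have "W (g + L) = W (g + L + p)"
      by (rule period_crosses_right_end[of W "g + L" q p g])
        (erule (1) run1(3) | use q L in simp)+
    with run1(2) show False by contradiction
  next
    case 3
    have "W (g + T) = W (g + T + q)" "W (g + T + p) = W (g + T + p + q)"
      by (rule per_l; use bounds 3 in simp)+
    then have "W (g + T) = W (g + T + p)"
      by (rule period_crosses_left_end[of W "g + T" q p "g + T + L"])
        (erule (1) run2(3) | use q L in simp)+
    with run2(1) show False by contradiction
  next
    case 4
    have "W (g + T + L - q) = W (g + T + L - q + q)"
      "W (g + T + L + p - q) = W (g + T + L + p - q + q)"
      by (rule per_l; use bounds 4 in auto)+
    then have "W (g + T + L) = W (g + T + L + p)"
      by (rule period_crosses_right_end[of W "g + T + L" q p "g + T"])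
        (erule (1) run2(3) | use q L in simp)+
    with run2(2) show False by contradiction
  qed
qed

end
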